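(* Let $A,B,C$ be a Leonard triple on $V$ that has $q$-Racah type with Huang data $(a,b,c,d)$, and let $W,W',W''$ be the associated elements of $\mathrm{End}(V)$ defined in the context. Then the three elements $W'W$, $W''W'$, $WW''$ mutually commute.
   Context: Let $\mathbb F$ be a field, $d\ge 0$ an integer, $V$ a vector space over $\mathbb F$ of dimension $d+1$, $\mathrm{End}(V)$ the $\mathbb F$-algebra of $\mathbb F$-linear maps $V\to V$, and $I$ its identity. A square matrix is tridiagonal if each nonzero entry lies on the diagonal, subdiagonal or superdiagonal; a tridiagonal matrix is irreducible if every subdiagonal entry and every superdiagonal entry is nonzero. Leonard triple on $V$: a 3-tuple $A,B,C$ of elements of $\mathrm{End}(V)$ such that (i) there is a basis of $V$ with respect to which $A$ is represented by a diagonal matrix and $B,C$ by irreducible tridiagonal matrices; (ii) there is a basis with respect to which $B$ is diagonal and $C,A$ are irreducible tridiagonal; (iii) there is a basis with respect to which $C$ is diagonal and $A,B$ are irreducible tridiagonal. Each of $A,B,C$ is then diagonalizable with one-dimensional eigenspaces. An ordering of the eigenvalues of $A$ is standard if corresponding eigenvectors, in that order, form a basis as in (i); similarly for $B$ with (ii) and $C$ with (iii). Standing assumptions: fix a nonzero $q\in\mathbb F$ with $q^4\ne 1$ and nonzero $a,b,c\in\mathbb F$ such that $q^{2i}\ne 1$ for $1\le i\le d$; none of $a^2,b^2,c^2$ is among $q^{2d-2},q^{2d-4},\ldots,q^{2-2d}$; none of $abc,a^{-1}bc,ab^{-1}c,abc^{-1}$ is among $q^{d-1},q^{d-3},\ldots,q^{1-d}$.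 For $0\le i\le d$ let $\theta_i=aq^{2i-d}+a^{-1}q^{d-2i}$, $\theta'_i=bq^{2i-d}+b^{-1}q^{d-2i}$, $\theta''_i=cq^{2i-d}+c^{-1}q^{d-2i}$. A Leonard triple $A,B,C$ on $V$ has $q$-Racah type with Huang data $(a,b,c,d)$ if $\{\theta_i\}_{i=0}^d$, $\{\theta'_i\}_{i=0}^d$, $\{\theta''_i\}_{i=0}^d$ are standard orderings of the eigenvalues of $A$, $B$, $C$ respectively, and $$A+\frac{qBC-q^{-1}CB}{q^2-q^{-2}}=\alpha_a I,\quad B+\frac{qCA-q^{-1}AC}{q^2-q^{-2}}=\alpha_b I,\quad C+\frac{qAB-q^{-1}BA}{q^2-q^{-2}}=\alpha_c I,$$ where $\alpha_a=\frac{(a+a^{-1})(q^{d+1}+q^{-d-1})+(b+b^{-1})(c+c^{-1})}{q+q^{-1}}$, $\alpha_b=\frac{(b+b^{-1})(q^{d+1}+q^{-d-1})+(c+c^{-1})(a+a^{-1})}{q+q^{-1}}$, $\alpha_c=\frac{(c+c^{-1})(q^{d+1}+q^{-d-1})+(a+a^{-1})(b+b^{-1})}{q+q^{-1}}$. For $0\le i\le d$ let $E_i$ (resp. $E'_i$, $E''_i$) be the primitive idempotent of $A$ (resp. $B$, $C$) for $\theta_i$ (resp. $\theta'_i$, $\theta''_i$): the projection of $V$ onto that eigenspace that is zero on the other eigenspaces. Define $$W=\sum_{i=0}^d(-1)^ia^{-i}q^{i(d-i)}E_i,\quad W'=\sum_{i=0}^d(-1)^ib^{-i}q^{i(d-i)}E'_i,\quad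 W''=\sum_{i=0}^d(-1)^ic^{-i}q^{i(d-i)}E''_i.$$ *)

theory Defs
  imports "Jordan_Normal_Form.Matrix"
begin

definition tridiagonal_mat :: "'a::zero mat \<Rightarrow> bool" where
  "tridiagonal_mat M \<longleftrightarrow> square_mat M \<and>
     (\<forall>i<dim_row M. \<forall>j<dim_col M. M $$ (i, j) \<noteq> 0 \<longrightarrow> i = j \<or> i = Suc j \<or> j = Suc i)"

definition irreducible_tridiagonal_mat :: "'a::zero mat \<Rightarrow> bool" where
  "irreducible_tridiagonal_mat M \<longleftrightarrow> tridiagonal_mat M \<and>
     (\<forall>i. Suc i < dim_row M \<longrightarrow> M $$ (Suc i, i) \<noteq> 0 \<and> M $$ (i, Suc i) \<noteq> 0)"

text \<open>
  The vector space \<open>V\<close> is the whole type \<open>'b\<close>, with scalar multiplication \<open>scale\<close>. Elements of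
  \<open>End(V)\<close> are functions satisfying \<open>Vector_Spaces.linear scale scale\<close>; their product is
  composition. The locale is a copy of \<open>vector_space\<close> (no further assumptions), as definitions made
  in \<open>vector_space\<close> itself would be captured by its global interpretation for real vector spaces.
\<close>

locale end_algebra = vector_space scale
  for scale :: "'a::field \<Rightarrow> 'b::ab_group_add \<Rightarrow> 'b"
begin

definition ordered_basis :: "nat \<Rightarrow> (nat \<Rightarrow> 'b) \<Rightarrow> bool" where
  "ordered_basis n v \<longleftrightarrow>
     inj_on v {..<n} \<and> independent (v ` {..<n}) \<and> span (v ` {..<n}) = UNIV"

definition represented_by :: "nat \<Rightarrow> (nat \<Rightarrow> 'b) \<Rightarrow> ('b \<Rightarrow> 'b) \<Rightarrow> 'a mat \<Rightarrow> bool" where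
  "represented_by n v A M \<longleftrightarrow> M \<in> carrier_mat n n \<and>
     (\<forall>j<n. A (v j) = (\<Sum>i<n. scale (M $$ (i, j)) (v i)))"

definition leonard_basis ::
  "nat \<Rightarrow> ('b \<Rightarrow> 'b) \<Rightarrow> ('b \<Rightarrow> 'b) \<Rightarrow> ('b \<Rightarrow> 'b) \<Rightarrow> (nat \<Rightarrow> 'b) \<Rightarrow> bool" where
  "leonard_basis d A B C v \<longleftrightarrow> ordered_basis (Suc d) v \<and>
     (\<exists>M. represented_by (Suc d) v A M \<and> diagonal_mat M) \<and>
     (\<exists>M. represented_by (Suc d) v B M \<and> irreducible_tridiagonal_mat M) \<and>
     (\<exists>M. represented_by (Suc d) v C M \<and> irreducible_tridiagonal_mat M)"

definition leonard_triple ::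
  "nat \<Rightarrow> ('b \<Rightarrow> 'b) \<Rightarrow> ('b \<Rightarrow> 'b) \<Rightarrow> ('b \<Rightarrow> 'b) \<Rightarrow> bool" where
  "leonard_triple d A B C \<longleftrightarrow>
     Vector_Spaces.linear scale scale A \<and>
     Vector_Spaces.linear scale scale B \<and>
     Vector_Spaces.linear scale scale C \<and>
     (\<exists>v. leonard_basis d A B C v) \<and>
     (\<exists>v. leonard_basis d B C A v) \<and>
     (\<exists>v. leonard_basis d C A B v)"

definition eigenspace :: "('b \<Rightarrow> 'b) \<Rightarrow> 'a \<Rightarrow> 'b set" where
  "eigenspace A t = {v. A v = scale t v}"

definition eigenvalues :: "('b \<Rightarrow> 'b) \<Rightarrow> 'a set" where
  "eigenvalues A = {t. \<exists>v. v \<noteq> 0 \<and> v \<in> eigenspace A t}"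

text \<open>
  A standard ordering of the eigenvalues of the first of the three maps. As the eigenspaces are
  one-dimensional, the choice of eigenvectors does not matter.
\<close>

definition standard_ordering ::
  "nat \<Rightarrow> ('b \<Rightarrow> 'b) \<Rightarrow> ('b \<Rightarrow> 'b) \<Rightarrow> ('b \<Rightarrow> 'b) \<Rightarrow> (nat \<Rightarrow> 'a) \<Rightarrow> bool" where
  "standard_ordering d A B C t \<longleftrightarrow> bij_betw t {..d} (eigenvalues A) \<and>
     (\<exists>v. leonard_basis d A B C v \<and> (\<forall>i\<le>d. v i \<in> eigenspace A (t i)))"

definition is_primitive_idempotent :: "('b \<Rightarrow> 'b) \<Rightarrow> 'a \<Rightarrow> ('b \<Rightarrow> 'b) \<Rightarrow> bool" where
  "is_primitive_idempotent A t E \<longleftrightarrow>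
     Vector_Spaces.linear scale scale E \<and>
     range E \<subseteq> eigenspace A t \<and>
     (\<forall>v\<in>eigenspace A t. E v = v) \<and>
     (\<forall>s. s \<noteq> t \<longrightarrow> (\<forall>v\<in>eigenspace A s. E v = 0))"

text \<open>
  Such an \<open>E\<close> exists and is unique if \<open>A\<close> is diagonalizable;
  see \<open>primitive_idempotent_works\<close> and \<open>primitive_idempotent_unique\<close> below.
\<close>

definition primitive_idempotent :: "('b \<Rightarrow> 'b) \<Rightarrow> 'a \<Rightarrow> 'b \<Rightarrow> 'b" where
  "primitive_idempotent A t = (THE E. is_primitive_idempotent A t E)"

end

definition huang_theta :: "'a::field \<Rightarrow> nat \<Rightarrow> 'a \<Rightarrow> nat \<Rightarrow> 'a" where
  "huang_theta q d a i =
     a * q powi (2 * int i - int d) + inverse a * q powi (int d - 2 * int i)"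

definition huang_alpha :: "'a::field \<Rightarrow> nat \<Rightarrow> 'a \<Rightarrow> 'a \<Rightarrow> 'a \<Rightarrow> 'a" where
  "huang_alpha q d a b c =
     ((a + inverse a) * (q powi (int d + 1) + q powi (- int d - 1))
       + (b + inverse b) * (c + inverse c)) / (q + inverse q)"

text \<open>
  The exponents \<open>2d-2, 2d-4, \<dots>, 2-2d\<close> are the numbers \<open>2k\<close> with \<open>1-d \<le> k \<le> d-1\<close>, and
  \<open>d-1, d-3, \<dots>, 1-d\<close> are the numbers \<open>d-1-2k\<close> with \<open>0 \<le> k < d\<close>; both lists are empty for
  \<open>d = 0\<close>.
\<close>

definition huang_parameters :: "'a::field \<Rightarrow> 'a \<Rightarrow> 'a \<Rightarrow> 'a \<Rightarrow> nat \<Rightarrow> bool" where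
  "huang_parameters q a b c d \<longleftrightarrow>
     q \<noteq> 0 \<and> q ^ 4 \<noteq> 1 \<and> a \<noteq> 0 \<and> b \<noteq> 0 \<and> c \<noteq> 0 \<and>
     (\<forall>i\<in>{1..d}. q ^ (2 * i) \<noteq> 1) \<and>
     (\<forall>x\<in>{a, b, c}. \<forall>k\<in>{1 - int d..int d - 1}. x\<^sup>2 \<noteq> q powi (2 * k)) \<and>
     (\<forall>x\<in>{a * b * c, inverse a * b * c, a * inverse b * c, a * b * inverse c}.
        \<forall>k<d. x \<noteq> q powi (int d - 1 - 2 * int k))"

context end_algebra
begin

definition huang_relation ::
  "'a \<Rightarrow> ('b \<Rightarrow> 'b) \<Rightarrow> ('b \<Rightarrow> 'b) \<Rightarrow> ('b \<Rightarrow> 'b) \<Rightarrow> 'a \<Rightarrow> bool" where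
  "huang_relation q A B C \<alpha> \<longleftrightarrow>
     (\<forall>v. A v + scale (1 / (q powi 2 - q powi (-2)))
                  (scale q (B (C v)) - scale (inverse q) (C (B v))) = scale \<alpha> v)"

definition q_racah_type ::
  "'a \<Rightarrow> ('b \<Rightarrow> 'b) \<Rightarrow> ('b \<Rightarrow> 'b) \<Rightarrow> ('b \<Rightarrow> 'b) \<Rightarrow> 'a \<Rightarrow> 'a \<Rightarrow> 'a \<Rightarrow> nat \<Rightarrow> bool" where
  "q_racah_type q A B C a b c d \<longleftrightarrow>
     standard_ordering d A B C (huang_theta q d a) \<and>
     standard_ordering d B C A (huang_theta q d b) \<and>
     standard_ordering d C A B (huang_theta q d c) \<and>
     huang_relation q A B C (huang_alpha q d a b c) \<and>
     huang_relation q B C A (huang_alpha q d b c a) \<and>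
     huang_relation q C A B (huang_alpha q d c a b)"

text \<open>\<open>W\<close>, \<open>W'\<close>, \<open>W''\<close> are obtained from \<open>(a, A)\<close>, \<open>(b, B)\<close>, \<open>(c, C)\<close>, respectively.\<close>

definition W_map :: "'a \<Rightarrow> nat \<Rightarrow> 'a \<Rightarrow> ('b \<Rightarrow> 'b) \<Rightarrow> 'b \<Rightarrow> 'b" where
  "W_map q d a A v =
     (\<Sum>i\<le>d. scale ((- 1) ^ i * a powi (- int i) * q ^ (i * (d - i)))
               (primitive_idempotent A (huang_theta q d a i) v))"

lemma linear_eqI_ordered_basis:
  assumes "ordered_basis n v"
    and "Vector_Spaces.linear scale scale f" "Vector_Spaces.linear scale scale g"
    and "\<And>i. i < n \<Longrightarrow> f (v i) = g (v i)"
  shows "f = g"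
proof
  fix x
  interpret vsp: vector_space_pair scale scale ..
  have "x \<in> span (v ` {..<n})" using assms(1) by (simp add: ordered_basis_def)
  then show "f x = g x"
    by (rule vsp.linear_eq_on[OF assms(2,3)]) (use assms(4) in auto)
qed

lemma is_primitive_idempotent_basis:
  assumes "ordered_basis n v" "inj_on t {..<n}" "\<And>j. j < n \<Longrightarrow> v j \<in> eigenspace A (t j)"
    and "i < n" "is_primitive_idempotent A (t i) E" "j < n"
  shows "E (v j) = (if j = i then v j else 0)"
  using assms unfolding is_primitive_idempotent_def inj_on_def
  by (metis lessThan_iff)

lemma primitive_idempotent_unique:
  assumes "ordered_basis n v" "inj_on t {..<n}" "\<And>j. j < n \<Longrightarrow> v j \<in> eigenspace A (t j)"
    and "i < n" "is_primitive_idempotent A (t i) E" "is_primitive_idempotent A (t i) F"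
  shows "E = F"
proof (rule linear_eqI_ordered_basis[OF assms(1)])
  show "Vector_Spaces.linear scale scale E" "Vector_Spaces.linear scale scale F"
    using assms(5,6) by (simp_all add: is_primitive_idempotent_def)
next
  fix j assume "j < n"
  then show "E (v j) = F (v j)"
    using is_primitive_idempotent_basis[OF assms(1-5)]
      is_primitive_idempotent_basis[OF assms(1-4,6)] by simp
qed

lemma is_primitive_idempotent_exists:
  assumes "ordered_basis n v" "Vector_Spaces.linear scale scale A"
    and "inj_on t {..<n}" "\<And>j. j < n \<Longrightarrow> v j \<in> eigenspace A (t j)" "i < n"
  shows "\<exists>E. is_primitive_idempotent A (t i) E"
proof -
  interpret vsp: vector_space_pair scale scale ..
  interpret A: Vector_Spaces.linear scale scale A by fact
  have inj: "inj_on v {..<n}" and ind: "independent (v ` {..<n})"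
    and sp: "span (v ` {..<n}) = UNIV"
    using assms(1) by (auto simp: ordered_basis_def)
  obtain E where linE: "Vector_Spaces.linear scale scale E"
    and E: "\<forall>x\<in>v ` {..<n}. E x = (if x = v i then x else 0)"
    using vsp.linear_independent_extend[OF ind, of "\<lambda>x. if x = v i then x else 0"] by blast
  interpret E: Vector_Spaces.linear scale scale E by fact
  have Ev: "E (v j) = (if j = i then v i else 0)" if "j < n" for j
    using E inj that assms(5) by (auto simp: inj_on_def)
  have Av: "A (v j) = scale (t j) (v j)" if "j < n" for j
    using assms(4)[OF that] by (simp add: eigenspace_def)
  have expand: "\<exists>u. x = (\<Sum>j<n. scale (u j) (v j))" for x
  proof -
    have "x \<in> span (v ` {..<n})" using sp by simp
    then obtain u where "x = (\<Sum>y\<in>v ` {..<n}. scale (u y) y)"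
      by (auto simp: span_finite)
    then have "x = (\<Sum>j<n. scale (u (v j)) (v j))"
      using inj by (simp add: sum.reindex)
    then show ?thesis by (rule exI[where x = "\<lambda>j. u (v j)"])
  qed
  have Eval: "E (\<Sum>j<n. scale (u j) (v j)) = scale (u i) (v i)" for u
  proof -
    have "E (\<Sum>j<n. scale (u j) (v j)) = (\<Sum>j<n. if j = i then scale (u i) (v i) else 0)"
      unfolding E.sum E.scale by (intro sum.cong) (simp_all add: Ev)
    then show ?thesis using assms(5) by simp
  qed
  have zero: "u j = 0" if "(\<Sum>j<n. scale (u j) (v j)) = 0" "j < n" for u j
  proof -
    have "(\<Sum>y\<in>v ` {..<n}. scale (u (the_inv_into {..<n} v y)) y) = 0"
      using that(1) inj by (simp add: sum.reindex the_inv_into_f_f)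
    then have "u (the_inv_into {..<n} v (v j)) = 0"
      using independentD[OF ind, of "v ` {..<n}" "\<lambda>y. u (the_inv_into {..<n} v y)"] that(2)
      by auto
    then show ?thesis using inj that(2) by (simp add: the_inv_into_f_f)
  qed
  have coeff: "u j = 0"
    if "(\<Sum>j<n. scale (u j) (v j)) \<in> eigenspace A s" "j < n" "t j \<noteq> s" for u s j
  proof -
    have "(\<Sum>j<n. scale (u j * (t j - s)) (v j)) = 0"
      using that(1)
      by (simp add: eigenspace_def A.sum A.scale Av scale_sum_right right_diff_distrib
          scale_left_diff_distrib sum_subtractf mult.commute)
    from zero[OF this that(2)] that(3) show ?thesis by simp
  qed
  have "is_primitive_idempotent A (t i) E"
    unfolding is_primitive_idempotent_def
  proof (intro conjI ballI allI impI subsetI)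
    show "Vector_Spaces.linear scale scale E" by fact
  next
    fix y assume "y \<in> range E"
    then obtain x where "y = E x" by auto
    with expand[of x] Eval obtain u where "y = scale u (v i)" by metis
    then show "y \<in> eigenspace A (t i)"
      using Av[OF assms(5)] by (simp add: eigenspace_def A.scale mult.commute)
  next
    fix x assume x: "x \<in> eigenspace A (t i)"
    obtain u where u: "x = (\<Sum>j<n. scale (u j) (v j))" using expand by blast
    have "u j = 0" if "j < n" "j \<noteq> i" for j
      using coeff[of u "t i" j] x u that assms(3,5) by (auto simp: inj_on_def)
    then have "x = (\<Sum>j<n. if j = i then scale (u i) (v i) else 0)"
      unfolding u by (intro sum.cong) auto
    then show "E x = x" using assms(5) Eval[of u] u by simp
  next
    fix s x assume s: "s \<noteq> t i" and x: "x \<in> eigenspace A s"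
    obtain u where u: "x = (\<Sum>j<n. scale (u j) (v j))" using expand by blast
    have "u i = 0" using coeff[of u s i] x u s assms(5) by auto
    then show "E x = 0" using Eval[of u] u by simp
  qed
  then show ?thesis by blast
qed

lemma primitive_idempotent_works:
  assumes "ordered_basis n v" "Vector_Spaces.linear scale scale A"
    and "inj_on t {..<n}" "\<And>j. j < n \<Longrightarrow> v j \<in> eigenspace A (t j)" "i < n"
  shows "is_primitive_idempotent A (t i) (primitive_idempotent A (t i))"
  unfolding primitive_idempotent_def
  using is_primitive_idempotent_exists[OF assms]
    primitive_idempotent_unique[OF assms(1,3,4,5)]
  by (metis theI)

end

end

theory Submission
  imports Defs
begin

text \<open>
  Put \<open>X = A + B + C\<close>. The idea is that each of \<open>W'W\<close>, \<open>W''W'\<close>, \<open>WW''\<close> commutes with \<open>X\<close>, and that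
  the centralizer of \<open>X\<close> in \<open>End(V)\<close> is commutative.

  For the first point, the third relation expresses \<open>C\<close> through \<open>A\<close> and \<open>B\<close>; let \<open>C'\<close> be the same
  expression with \<open>A\<close> and \<open>B\<close> interchanged. In the eigenbasis of \<open>A\<close> the matrix entries of \<open>B + C\<close>
  and \<open>B + C'\<close> agree on the diagonal, and next to it they are those of \<open>B\<close> times \<open>1 - u\<close> or
  \<open>1 - 1/u\<close>, where \<open>u = a q\<^bsup>2i+1-d\<^esup>\<close>, with the two factors exchanged between \<open>C\<close> and \<open>C'\<close>. Since
  \<open>1 - 1/u = (-1/u) (1 - u)\<close> and \<open>-1/u\<close> is exactly the ratio of consecutive eigenvalues of \<open>W\<close>, this
  gives \<open>W X = (A + B + C') W\<close> (lemma \<open>W_map_intertwines\<close>). The same lemma in the eigenbasis of \<open>B\<close>,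
  where \<open>C\<close> and \<open>C'\<close> trade places, gives \<open>W' (A + B + C') = X W'\<close>. Hence \<open>W'W X = X W'W\<close>, and the
  other two products follow by cyclic symmetry.

  For the second point, \<open>X\<close> is tridiagonal in the eigenbasis of \<open>A\<close>, and its subdiagonal entries are
  those of \<open>B\<close> times \<open>1 - u\<close>. The condition on \<open>a\<^sup>2\<close> rules out \<open>u = 1\<close>, so the first eigenvector of
  \<open>A\<close> is cyclic for \<open>X\<close>, and an operator with a cyclic vector has a commutative centralizer
  (lemma \<open>centralizer_commutative\<close>).
\<close>

section \<open>The scalars\<close>

definition twist_eigenvalue :: "'a::field \<Rightarrow> nat \<Rightarrow> 'a \<Rightarrow> nat \<Rightarrow> 'a" where
  "twist_eigenvalue q d a i = (- 1) ^ i * a powi (- int i) * q ^ (i * (d - i))"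

text \<open>
  The factor by which the entry \<open>(i, j)\<close> of \<open>Q\<close> is multiplied when the \<open>q\<close>-commutator of \<open>P\<close> and \<open>Q\<close>,
  suitably normalized, is subtracted from \<open>Q\<close>; here \<open>P\<close> is diagonal with entries \<open>huang_theta q d a\<close>.
\<close>

definition entry_factor :: "'a::field \<Rightarrow> nat \<Rightarrow> 'a \<Rightarrow> nat \<Rightarrow> nat \<Rightarrow> 'a" where
  "entry_factor q d a i j =
     1 - 1 / (q powi 2 - q powi (-2)) * (q * huang_theta q d a i - inverse q * huang_theta q d a j)"

lemma q_square_diff_nonzero:
  fixes q :: "'a::field"
  assumes "q \<noteq> 0" "q ^ 4 \<noteq> 1"
  shows "q powi 2 - q powi (-2) \<noteq> 0"
proof
  assume "q powi 2 - q powi (-2) = 0"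
  then have "q ^ 2 * q ^ 2 = 1"
    using assms(1) by (simp add: power_int_def field_simps)
  then show False
    using assms(2) by (simp flip: power_add)
qed

lemma entry_factor_neighbours:
  fixes q a :: "'a::field" and i d :: nat
  defines "u \<equiv> a * q powi (2 * int i + 1 - int d)"
  assumes "q \<noteq> 0" "q ^ 4 \<noteq> 1" "a \<noteq> 0"
  shows "entry_factor q d a (Suc i) i = 1 - u"
    and "entry_factor q d a i (Suc i) = 1 - inverse u"
proof -
  define e where "e = q powi (2 * int i + 1 - int d)"
  have e: "e \<noteq> 0" using assms(2) by (simp add: e_def)
  have p1: "q powi (2 * int i - int d) = e / q"
    using assms(2) power_int_diff[of q "2 * int i + 1 - int d" 1] by (simp add: e_def)
  have p2: "q powi (int d - 2 * int i) = q / e"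
    using assms(2) power_int_diff[of q 1 "2 * int i + 1 - int d"] by (simp add: e_def)
  have p3: "q powi (2 * int (Suc i) - int d) = e * q"
    using assms(2) power_int_add[of q "2 * int i + 1 - int d" 1]
    by (simp add: e_def algebra_simps)
  have p4: "q powi (int d - 2 * int (Suc i)) = inverse (e * q)"
    by (subst p3[symmetric], subst power_int_minus[symmetric]) simp
  have D: "q powi 2 - q powi (-2) = q ^ 2 - inverse (q ^ 2)"
    by (simp add: power_int_minus)
  have D0: "q ^ 2 - inverse (q ^ 2) \<noteq> 0"
    using q_square_diff_nonzero[OF assms(2,3)] D by simp
  have 1: "q * huang_theta q d a (Suc i) - inverse q * huang_theta q d a i
      = u * (q ^ 2 - inverse (q ^ 2))"
    unfolding huang_theta_def p1 p2 p3 p4 u_def e_def[symmetric]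
    using e assms(2,4) by (simp add: field_simps power2_eq_square)
  have 2: "q * huang_theta q d a i - inverse q * huang_theta q d a (Suc i)
      = inverse u * (q ^ 2 - inverse (q ^ 2))"
    unfolding huang_theta_def p1 p2 p3 p4 u_def e_def[symmetric]
    using e assms(2,4) by (simp add: field_simps power2_eq_square)
  show "entry_factor q d a (Suc i) i = 1 - u"
    unfolding entry_factor_def D 1 using D0 by simp
  show "entry_factor q d a i (Suc i) = 1 - inverse u"
    unfolding entry_factor_def D 2 using D0 by simp
qed

lemma twist_eigenvalue_Suc:
  fixes q a :: "'a::field"
  assumes "q \<noteq> 0" "a \<noteq> 0" "i < d"
  shows "twist_eigenvalue q d a (Suc i) * (a * q powi (2 * int i + 1 - int d))
    = - twist_eigenvalue q d a i"
proof -
  obtain k where d: "d = Suc (i + k)"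
    using assms(3) less_iff_Suc_add by auto
  have "q ^ (Suc i * k) * q powi (2 * int i + 1 - int d) = q ^ (i * Suc k)"
    using assms(1) unfolding d power_int_of_nat[symmetric]
    by (subst power_int_add[symmetric]) (auto simp: algebra_simps)
  moreover have "a powi (- int (Suc i)) * a = a powi (- int i)"
    using assms(2) power_int_add[of a "- int (Suc i)" 1] by simp
  moreover have "twist_eigenvalue q d a (Suc i) * (a * q powi (2 * int i + 1 - int d))
      = - ((- 1) ^ i * (a powi (- int (Suc i)) * a)
          * (q ^ (Suc i * k) * q powi (2 * int i + 1 - int d)))"
    by (simp add: twist_eigenvalue_def d mult_ac del: of_nat_Suc)
  ultimately show ?thesis
    unfolding twist_eigenvalue_def d by simp
qed

text \<open>
  This is where the definition of \<open>W\<close> enters: its eigenvalues symmetrize the entry factors next to the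
  diagonal.
\<close>

lemma twist_eigenvalue_symmetrizes:
  fixes q a :: "'a::field"
  assumes "q \<noteq> 0" "q ^ 4 \<noteq> 1" "a \<noteq> 0" "i \<le> d" "j \<le> d" "i = j \<or> i = Suc j \<or> j = Suc i"
  shows "twist_eigenvalue q d a i * entry_factor q d a i j
    = twist_eigenvalue q d a j * entry_factor q d a j i"
proof -
  have step: "twist_eigenvalue q d a (Suc k) * entry_factor q d a (Suc k) k
      = twist_eigenvalue q d a k * entry_factor q d a k (Suc k)" if "k < d" for k
  proof -
    define u where "u = a * q powi (2 * int k + 1 - int d)"
    have u: "u \<noteq> 0" using assms(1,3) by (simp add: u_def)
    have "twist_eigenvalue q d a k = - (twist_eigenvalue q d a (Suc k) * u)"
      using twist_eigenvalue_Suc[OF assms(1,3) that] by (simp add: u_def)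
    then show ?thesis
      unfolding entry_factor_neighbours[OF assms(1-3), of d k, folded u_def]
      using u by (simp add: algebra_simps)
  qed
  show ?thesis
    using assms(4-6) step[of i] step[of j] by auto
qed

text \<open>
  If \<open>1 - u\<close> vanished, \<open>a\<close> would be \<open>q\<^bsup>d-1-2j\<^esup>\<close>, whose square is one of the excluded values of \<open>a\<^sup>2\<close>.
\<close>

lemma entry_factor_subdiagonal_nonzero:
  assumes "huang_parameters q a b c d" "Suc j \<le> d"
  shows "entry_factor q d a (Suc j) j \<noteq> 0"
proof
  have q: "q \<noteq> 0" "q ^ 4 \<noteq> 1" "a \<noteq> 0"
    and a2: "\<forall>k\<in>{1 - int d..int d - 1}. a\<^sup>2 \<noteq> q powi (2 * k)"
    using assms(1) by (auto simp: huang_parameters_def)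
  define k where "k = int d - 1 - 2 * int j"
  assume "entry_factor q d a (Suc j) j = 0"
  then have "a * q powi (- k) = 1"
    using entry_factor_neighbours(1)[OF q, of d j] by (simp add: k_def algebra_simps)
  then have "a = q powi k"
    using q by (simp add: power_int_minus field_simps)
  then have "a\<^sup>2 = q powi (2 * k)"
    by (metis mult.commute power_int_mult power_int_numeral)
  moreover have "k \<in> {1 - int d..int d - 1}"
    using assms(2) by (auto simp: k_def)
  ultimately show False
    using a2 by blast
qed

context end_algebra
begin

section \<open>Operators with a cyclic vector\<close>

lemma linear_iff:
  "Vector_Spaces.linear scale scale f \<longleftrightarrow>
     (\<forall>x y. f (x + y) = f x + f y) \<and> (\<forall>r x. f (scale r x) = scale r (f x))"
  by (simp add: Vector_Spaces.linear_iff vector_space_axioms)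

lemma subspace_contains_ordered_basis:
  assumes "ordered_basis n v" "subspace U" "\<And>i. i < n \<Longrightarrow> v i \<in> U"
  shows "x \<in> U"
proof -
  have "span (v ` {..<n}) \<subseteq> U"
    using assms(2,3) by (intro span_minimal) auto
  then show ?thesis
    using assms(1) by (auto simp: ordered_basis_def)
qed

text \<open>
  An \<open>X\<close>-invariant subspace that contains \<open>v 0, \<dots>, v j\<close> also contains \<open>v (Suc j)\<close>: the last nonzero
  term of \<open>X (v j)\<close> is a nonzero multiple of it, and the other terms involve earlier vectors only.
\<close>

lemma first_vector_cyclic:
  assumes basis: "ordered_basis n v"
    and act: "\<And>j. j < n \<Longrightarrow> X (v j) = (\<Sum>i<n. scale (N i j) (v i))"
    and below: "\<And>i j. i < n \<Longrightarrow> Suc j < i \<Longrightarrow> N i j = 0"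
    and sub: "\<And>j. Suc j < n \<Longrightarrow> N (Suc j) j \<noteq> 0"
    and U: "subspace U" "v 0 \<in> U" "\<And>x. x \<in> U \<Longrightarrow> X x \<in> U"
  shows "x \<in> U"
proof (rule subspace_contains_ordered_basis[OF basis U(1)])
  fix i assume "i < n"
  then show "v i \<in> U"
  proof (induction i rule: less_induct)
    case (less i)
    show ?case
    proof (cases i)
      case 0
      then show ?thesis using U(2) by simp
    next
      case (Suc j)
      have "X (v j) = scale (N i j) (v i) + (\<Sum>k\<in>{..<n} - {i}. scale (N k j) (v k))"
        using less.prems Suc by (subst act) (auto simp: sum.remove)
      then have "scale (N i j) (v i) = X (v j) - (\<Sum>k\<in>{..<n} - {i}. scale (N k j) (v k))"
        by simp
      moreover have "X (v j) \<in> U"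
        using less Suc U(3) by auto
      moreover have "(\<Sum>k\<in>{..<n} - {i}. scale (N k j) (v k)) \<in> U"
      proof (rule subspace_sum[OF U(1)])
        fix k assume k: "k \<in> {..<n} - {i}"
        show "scale (N k j) (v k) \<in> U"
        proof (cases "k < i")
          case True
          then show ?thesis using less.IH[of k] k U(1) by (auto intro: subspace_scale)
        next
          case False
          then have "N k j = 0" using below[of k j] k Suc by auto
          then show ?thesis using U(1) by (simp add: subspace_0)
        qed
      qed
      ultimately have "scale (N i j) (v i) \<in> U"
        using U(1) by (simp add: subspace_diff)
      then have "scale (inverse (N i j)) (scale (N i j) (v i)) \<in> U"
        using U(1) by (rule subspace_scale[rotated])
      then show ?thesis
        using sub[of j] less.prems Suc by simp
    qed
  qed
qed

text \<open>
  An element of the centralizer is determined by its value at a cyclic vector \<open>e\<close>, and every vector is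
  the value at \<open>e\<close> of some central element of the centralizer. The second claim is usually shown with
  polynomials in \<open>X\<close>; it suffices that these values form an \<open>X\<close>-invariant subspace containing \<open>e\<close>.
\<close>

lemma centralizer_commutative:
  assumes X: "Vector_Spaces.linear scale scale X"
    and cyclic: "\<And>U x. subspace U \<Longrightarrow> e \<in> U \<Longrightarrow> (\<And>x. x \<in> U \<Longrightarrow> X x \<in> U) \<Longrightarrow> x \<in> U"
    and F: "Vector_Spaces.linear scale scale F" "\<And>x. F (X x) = X (F x)"
    and G: "Vector_Spaces.linear scale scale G" "\<And>x. G (X x) = X (G x)"
  shows "F \<circ> G = G \<circ> F"
proof -
  interpret X: Vector_Spaces.linear scale scale X by fact
  define Z where "Z = {H. Vector_Spaces.linear scale scale H \<and> (\<forall>x. H (X x) = X (H x))}"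
  define ZZ where "ZZ = {H\<in>Z. \<forall>K\<in>Z. \<forall>x. H (K x) = K (H x)}"
  have Z_add: "K (x + y) = K x + K y" and Z_scale: "K (scale r x) = scale r (K x)"
    and Z_X: "K (X x) = X (K x)" if "K \<in> Z" for K x y r
    using that by (auto simp: Z_def linear_iff)
  have Z_zero: "K 0 = 0" if "K \<in> Z" for K
    using Z_scale[OF that, of 0 0] by simp
  have eqI: "H x = K x" if "H \<in> Z" "K \<in> Z" "H e = K e" for H K x
  proof -
    have "x \<in> {x. H x = K x}"
    proof (rule cyclic)
      show "subspace {x. H x = K x}"
        using that(1,2) by (auto simp: subspace_def Z_zero Z_add Z_scale)
    qed (use that in \<open>auto simp: Z_X\<close>)
    then show ?thesis by simp
  qed
  have orbit: "x \<in> (\<lambda>H. H e) ` ZZ" for x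
  proof (rule cyclic)
    show "subspace ((\<lambda>H. H e) ` ZZ)"
    proof (rule subspaceI)
      have "(\<lambda>x. 0) \<in> Z"
        by (simp add: Z_def linear_iff X.zero)
      then have "(\<lambda>x. 0) \<in> ZZ"
        by (simp add: ZZ_def Z_zero)
      then show "0 \<in> (\<lambda>H. H e) ` ZZ" by (rule rev_image_eqI) simp
    next
      fix x y assume "x \<in> (\<lambda>H. H e) ` ZZ" "y \<in> (\<lambda>H. H e) ` ZZ"
      then obtain H K where HK: "H \<in> ZZ" "K \<in> ZZ" "x = H e" "y = K e" by auto
      then have "(\<lambda>x. H x + K x) \<in> Z"
        by (simp add: ZZ_def Z_def linear_iff X.add scale_right_distrib)
      with HK have "(\<lambda>x. H x + K x) \<in> ZZ"
        by (simp add: ZZ_def Z_add)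
      then show "x + y \<in> (\<lambda>H. H e) ` ZZ" by (rule rev_image_eqI) (simp add: HK)
    next
      fix r x assume "x \<in> (\<lambda>H. H e) ` ZZ"
      then obtain H where H: "H \<in> ZZ" "x = H e" by auto
      then have "(\<lambda>x. scale r (H x)) \<in> Z"
        by (simp add: ZZ_def Z_def linear_iff X.scale scale_right_distrib mult.commute)
      with H have "(\<lambda>x. scale r (H x)) \<in> ZZ"
        by (simp add: ZZ_def Z_scale)
      then show "scale r x \<in> (\<lambda>H. H e) ` ZZ" by (rule rev_image_eqI) (simp add: H)
    qed
  next
    have "(\<lambda>x. x) \<in> ZZ"
      by (simp add: ZZ_def Z_def linear_iff)
    then show "e \<in> (\<lambda>H. H e) ` ZZ" by (rule rev_image_eqI) simp
  next
    fix x assume "x \<in> (\<lambda>H. H e) ` ZZ"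
    then obtain H where H: "H \<in> ZZ" "x = H e" by auto
    then have "(\<lambda>x. X (H x)) \<in> Z"
      by (simp add: ZZ_def Z_def linear_iff X.add X.scale)
    with H have "(\<lambda>x. X (H x)) \<in> ZZ"
      by (simp add: ZZ_def Z_X)
    then show "X x \<in> (\<lambda>H. H e) ` ZZ" by (rule rev_image_eqI) (simp add: H)
  qed
  have FZ: "F \<in> Z" and GZ: "G \<in> Z"
    using F G by (auto simp: Z_def)
  obtain H where H: "H \<in> ZZ" "F e = H e"
    using orbit[of "F e"] by auto
  then have HZ: "H \<in> Z" and HG: "\<And>x. H (G x) = G (H x)"
    using GZ by (auto simp: ZZ_def)
  show ?thesis
    using eqI[OF FZ HZ H(2)] HG by (simp add: fun_eq_iff)
qed

section \<open>The intertwining property\<close>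

text \<open>The operator that the relation \<open>huang_relation q R P Q \<alpha>\<close> forces \<open>R\<close> to be.\<close>

definition third_operator ::
  "'a \<Rightarrow> 'a \<Rightarrow> ('b \<Rightarrow> 'b) \<Rightarrow> ('b \<Rightarrow> 'b) \<Rightarrow> 'b \<Rightarrow> 'b" where
  "third_operator q \<alpha> P Q x = scale \<alpha> x
     - scale (1 / (q powi 2 - q powi (-2))) (scale q (P (Q x)) - scale (inverse q) (Q (P x)))"

lemma huang_relation_third_operator:
  "huang_relation q R P Q \<alpha> \<longleftrightarrow> R = third_operator q \<alpha> P Q"
  unfolding huang_relation_def third_operator_def fun_eq_iff eq_diff_eq ..

lemma linear_third_operator:
  assumes "Vector_Spaces.linear scale scale P" "Vector_Spaces.linear scale scale Q"
  shows "Vector_Spaces.linear scale scale (third_operator q \<alpha> P Q)"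
  using assms unfolding linear_iff third_operator_def
  by (simp add: scale_right_distrib scale_right_diff_distrib mult.commute algebra_simps)

lemma third_operator_on_eigenbasis:
  assumes P: "Vector_Spaces.linear scale scale P"
    and Q: "Vector_Spaces.linear scale scale Q"
    and eig: "\<And>i. i < n \<Longrightarrow> P (v i) = scale (huang_theta q d a i) (v i)"
    and act: "\<And>j. j < n \<Longrightarrow> Q (v j) = (\<Sum>i<n. scale (M i j) (v i))"
    and j: "j < n"
  shows "Q (v j) + third_operator q \<alpha> P Q (v j)
      = scale \<alpha> (v j) + (\<Sum>i<n. scale (M i j * entry_factor q d a i j) (v i))"
    and "Q (v j) + third_operator q \<alpha> Q P (v j)
      = scale \<alpha> (v j) + (\<Sum>i<n. scale (M i j * entry_factor q d a j i) (v i))"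
proof -
  interpret P: Vector_Spaces.linear scale scale P by fact
  interpret Q: Vector_Spaces.linear scale scale Q by fact
  let ?D = "1 / (q powi 2 - q powi (-2))" and ?t = "huang_theta q d a"
  have PQ: "P (Q (v j)) = (\<Sum>i<n. scale (M i j * ?t i) (v i))"
    using j by (simp add: act P.sum P.scale eig)
  have QP: "Q (P (v j)) = (\<Sum>i<n. scale (M i j * ?t j) (v i))"
    using j by (simp add: act eig Q.scale scale_sum_right mult.commute)
  have split: "M i j * entry_factor q d a i j
      = M i j - ?D * (q * (M i j * ?t i) - inverse q * (M i j * ?t j))"
    "M i j * entry_factor q d a j i
      = M i j - ?D * (q * (M i j * ?t j) - inverse q * (M i j * ?t i))" for i
    by (simp_all add: entry_factor_def algebra_simps)
  have collect: "(\<Sum>i<n. scale (f i - r * (s * g i - t * h i)) (v i))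
      = (\<Sum>i<n. scale (f i) (v i)) - scale r (scale s (\<Sum>i<n. scale (g i) (v i))
          - scale t (\<Sum>i<n. scale (h i) (v i)))" for f g h r s t
    by (simp only: scale_left_diff_distrib sum_subtractf scale_sum_right
        scale_scale[symmetric] scale_right_diff_distrib)
  show "Q (v j) + third_operator q \<alpha> P Q (v j)
      = scale \<alpha> (v j) + (\<Sum>i<n. scale (M i j * entry_factor q d a i j) (v i))"
    unfolding third_operator_def PQ QP
    unfolding act[OF j] split collect by simp
  show "Q (v j) + third_operator q \<alpha> Q P (v j)
      = scale \<alpha> (v j) + (\<Sum>i<n. scale (M i j * entry_factor q d a j i) (v i))"
    unfolding third_operator_def PQ QP
    unfolding act[OF j] split collect by simp
qed

lemma W_map_on_eigenbasis:
  assumes basis: "ordered_basis (Suc d) v"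
    and P: "Vector_Spaces.linear scale scale P"
    and inj: "inj_on (huang_theta q d a) {..<Suc d}"
    and eig: "\<And>i. i < Suc d \<Longrightarrow> v i \<in> eigenspace P (huang_theta q d a i)"
  shows "Vector_Spaces.linear scale scale (W_map q d a P)"
    and "j < Suc d \<Longrightarrow> W_map q d a P (v j) = scale (twist_eigenvalue q d a j) (v j)"
proof -
  let ?E = "\<lambda>i. primitive_idempotent P (huang_theta q d a i)"
  have E: "is_primitive_idempotent P (huang_theta q d a i) (?E i)" if "i \<le> d" for i
    using primitive_idempotent_works[OF basis P inj eig] that by simp
  then have lin: "?E i (x + y) = ?E i x + ?E i y" "?E i (scale r x) = scale r (?E i x)"
    if "i \<le> d" for i x y r
    using that by (auto simp: is_primitive_idempotent_def linear_iff)
  show "Vector_Spaces.linear scale scale (W_map q d a P)"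
    unfolding linear_iff W_map_def
    by (simp add: lin scale_right_distrib sum.distrib scale_sum_right mult.commute)
  assume j: "j < Suc d"
  have "W_map q d a P (v j)
      = (\<Sum>i\<le>d. if i = j then scale (twist_eigenvalue q d a j) (v j) else 0)"
    unfolding W_map_def
  proof (rule sum.cong[OF refl])
    fix i assume "i \<in> {..d}"
    then have "?E i (v j) = (if j = i then v j else 0)"
      using is_primitive_idempotent_basis[OF basis inj eig _ E j] by simp
    then show "scale ((- 1) ^ i * a powi - int i * q ^ (i * (d - i))) (?E i (v j))
        = (if i = j then scale (twist_eigenvalue q d a j) (v j) else 0)"
      by (simp add: twist_eigenvalue_def)
  qed
  then show "W_map q d a P (v j) = scale (twist_eigenvalue q d a j) (v j)"
    using j by simp
qed

text \<open>
  The part of the hypotheses that concerns an ordered pair of the three maps, with the eigenbasis of the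
  first of them made explicit.
\<close>

definition eigenbasis_tridiagonal ::
  "'a \<Rightarrow> nat \<Rightarrow> 'a \<Rightarrow> ('b \<Rightarrow> 'b) \<Rightarrow> ('b \<Rightarrow> 'b) \<Rightarrow> (nat \<Rightarrow> 'b) \<Rightarrow> 'a mat \<Rightarrow> bool" where
  "eigenbasis_tridiagonal q d a P Q v M \<longleftrightarrow>
     ordered_basis (Suc d) v \<and> inj_on (huang_theta q d a) {..<Suc d} \<and>
     (\<forall>i<Suc d. v i \<in> eigenspace P (huang_theta q d a i)) \<and>
     represented_by (Suc d) v Q M \<and> irreducible_tridiagonal_mat M"

lemma standard_ordering_eigenbasis:
  assumes "standard_ordering d P Q R (huang_theta q d a)"
  shows "\<exists>v M. eigenbasis_tridiagonal q d a P Q v M"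
    and "\<exists>v M. eigenbasis_tridiagonal q d a P R v M"
  using assms
  unfolding standard_ordering_def leonard_basis_def eigenbasis_tridiagonal_def
    lessThan_Suc_atMost less_Suc_eq_le bij_betw_def
  by blast+

lemma eigenbasis_tridiagonal_zero:
  assumes "eigenbasis_tridiagonal q d a P Q v M"
    and "i < Suc d" "j < Suc d" "\<not> (i = j \<or> i = Suc j \<or> j = Suc i)"
  shows "M $$ (i, j) = 0"
proof -
  have "tridiagonal_mat M" "dim_row M = Suc d" "dim_col M = Suc d"
    using assms(1)
    by (auto simp: eigenbasis_tridiagonal_def represented_by_def irreducible_tridiagonal_mat_def)
  then show ?thesis
    using assms(2-4) unfolding tridiagonal_mat_def by metis
qed

lemma W_map_intertwines:
  assumes q: "q \<noteq> 0" "q ^ 4 \<noteq> 1" "a \<noteq> 0"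
    and P: "Vector_Spaces.linear scale scale P"
    and Q: "Vector_Spaces.linear scale scale Q"
    and tri: "eigenbasis_tridiagonal q d a P Q v M"
  shows "W_map q d a P (P x + Q x + third_operator q \<alpha> P Q x)
    = P (W_map q d a P x) + Q (W_map q d a P x) + third_operator q \<alpha> Q P (W_map q d a P x)"
proof -
  interpret P: Vector_Spaces.linear scale scale P by fact
  interpret Q: Vector_Spaces.linear scale scale Q by fact
  let ?W = "W_map q d a P" and ?R = "third_operator q \<alpha> P Q" and ?R' = "third_operator q \<alpha> Q P"
  let ?w = "twist_eigenvalue q d a"
  have basis: "ordered_basis (Suc d) v" and inj: "inj_on (huang_theta q d a) {..<Suc d}"
    and eig: "\<And>i. i < Suc d \<Longrightarrow> v i \<in> eigenspace P (huang_theta q d a i)"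
    using tri by (auto simp: eigenbasis_tridiagonal_def)
  have Pv: "P (v i) = scale (huang_theta q d a i) (v i)" if "i < Suc d" for i
    using eig[OF that] by (simp add: eigenspace_def)
  have Qv: "Q (v j) = (\<Sum>i<Suc d. scale (M $$ (i, j)) (v i))" if "j < Suc d" for j
    using tri that by (auto simp: eigenbasis_tridiagonal_def represented_by_def)
  have M0: "M $$ (i, j) = 0"
    if "i < Suc d" "j < Suc d" "\<not> (i = j \<or> i = Suc j \<or> j = Suc i)" for i j
    using eigenbasis_tridiagonal_zero[OF tri that] .
  have linW: "Vector_Spaces.linear scale scale ?W"
    and Wv: "\<And>j. j < Suc d \<Longrightarrow> ?W (v j) = scale (?w j) (v j)"
    using W_map_on_eigenbasis[OF basis P inj eig] by auto
  have linR: "Vector_Spaces.linear scale scale ?R" "Vector_Spaces.linear scale scale ?R'"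
    using linear_third_operator P Q by auto
  interpret W: Vector_Spaces.linear scale scale ?W by fact
  interpret R': Vector_Spaces.linear scale scale ?R' by fact
  have "(\<lambda>x. ?W (P x + (Q x + ?R x))) = (\<lambda>x. P (?W x) + (Q (?W x) + ?R' (?W x)))"
  proof (rule linear_eqI_ordered_basis[OF basis])
    show "Vector_Spaces.linear scale scale (\<lambda>x. ?W (P x + (Q x + ?R x)))"
      "Vector_Spaces.linear scale scale (\<lambda>x. P (?W x) + (Q (?W x) + ?R' (?W x)))"
      using P Q linW linR unfolding linear_iff by (simp_all add: scale_right_distrib add_ac)
  next
    fix j assume j: "j < Suc d"
    have entry: "scale (M $$ (i, j) * entry_factor q d a i j) (?W (v i))
        = scale (?w j) (scale (M $$ (i, j) * entry_factor q d a j i) (v i))"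
      if "i \<in> {..<Suc d}" for i
    proof (cases "i = j \<or> i = Suc j \<or> j = Suc i")
      case True
      then show ?thesis
        using twist_eigenvalue_symmetrizes[OF q _ _ True] that j
        by (simp add: Wv mult.assoc mult.commute mult.left_commute)
    next
      case False
      then show ?thesis using M0[of i j] that j by simp
    qed
    have sum: "(\<Sum>i<Suc d. scale (M $$ (i, j) * entry_factor q d a i j) (?W (v i)))
        = scale (?w j) (\<Sum>i<Suc d. scale (M $$ (i, j) * entry_factor q d a j i) (v i))"
      unfolding scale_sum_right by (rule sum.cong[OF refl entry])
    have "?W (P (v j)) = scale (?w j) (P (v j))"
      using j by (simp add: Pv W.scale Wv mult.commute)
    moreover have "?W (Q (v j) + ?R (v j)) = scale (?w j) (Q (v j) + ?R' (v j))"
    proof -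
      have QR: "Q (v j) + ?R (v j)
          = scale \<alpha> (v j) + (\<Sum>i<Suc d. scale (M $$ (i, j) * entry_factor q d a i j) (v i))"
        and QR': "Q (v j) + ?R' (v j)
          = scale \<alpha> (v j) + (\<Sum>i<Suc d. scale (M $$ (i, j) * entry_factor q d a j i) (v i))"
        by (rule third_operator_on_eigenbasis[OF P Q _ _ j]; fact Pv Qv)+
      show ?thesis
        unfolding QR QR'
        unfolding W.add W.scale W.sum Wv[OF j] scale_right_distrib sum
        by (simp only: scale_left_commute)
    qed
    ultimately show "?W (P (v j) + (Q (v j) + ?R (v j)))
        = P (?W (v j)) + (Q (?W (v j)) + ?R' (?W (v j)))"
      unfolding W.add by (simp add: Wv[OF j] P.scale Q.scale R'.scale scale_right_distrib W.add)
  qed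
  then show ?thesis by (simp add: fun_eq_iff add.assoc)
qed

text \<open>
  Going through \<open>W\<close> replaces the third operator \<open>R\<close> by its opposite, and going through \<open>W'\<close> changes it
  back.
\<close>

lemma W_map_product_commutes:
  assumes q: "q \<noteq> 0" "q ^ 4 \<noteq> 1" "a \<noteq> 0" "b \<noteq> 0"
    and P: "Vector_Spaces.linear scale scale P"
    and Q: "Vector_Spaces.linear scale scale Q"
    and PQ: "eigenbasis_tridiagonal q d a P Q v M"
    and QP: "eigenbasis_tridiagonal q d b Q P v' M'"
    and R: "huang_relation q R P Q \<alpha>"
  shows "(W_map q d b Q \<circ> W_map q d a P) (P x + Q x + R x)
    = P ((W_map q d b Q \<circ> W_map q d a P) x) + Q ((W_map q d b Q \<circ> W_map q d a P) x)
      + R ((W_map q d b Q \<circ> W_map q d a P) x)"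
  using W_map_intertwines[OF q(1-3) P Q PQ, of x \<alpha>]
    W_map_intertwines[OF q(1,2,4) Q P QP, of "W_map q d a P x" \<alpha>] R
  by (simp add: huang_relation_third_operator add.commute)

lemma linear_W_map:
  assumes "eigenbasis_tridiagonal q d a P Q v M" "Vector_Spaces.linear scale scale P"
  shows "Vector_Spaces.linear scale scale (W_map q d a P)"
  using assms W_map_on_eigenbasis(1) unfolding eigenbasis_tridiagonal_def by blast

lemma sum_has_cyclic_vector:
  assumes params: "huang_parameters q a b c d"
    and P: "Vector_Spaces.linear scale scale P"
    and Q: "Vector_Spaces.linear scale scale Q"
    and tri: "eigenbasis_tridiagonal q d a P Q v M"
    and R: "huang_relation q R P Q \<alpha>"
    and U: "subspace U" "v 0 \<in> U" "\<And>x. x \<in> U \<Longrightarrow> P x + Q x + R x \<in> U"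
  shows "x \<in> U"
proof -
  let ?t = "huang_theta q d a"
  define N where "N i j = M $$ (i, j) * entry_factor q d a i j + (if i = j then ?t j + \<alpha> else 0)"
    for i j
  have Pv: "P (v i) = scale (?t i) (v i)" if "i < Suc d" for i
    using tri that by (auto simp: eigenbasis_tridiagonal_def eigenspace_def)
  have Qv: "Q (v j) = (\<Sum>i<Suc d. scale (M $$ (i, j)) (v i))" if "j < Suc d" for j
    using tri that by (auto simp: eigenbasis_tridiagonal_def represented_by_def)
  have M: "irreducible_tridiagonal_mat M" "M \<in> carrier_mat (Suc d) (Suc d)"
    using tri by (auto simp: eigenbasis_tridiagonal_def represented_by_def)
  have M0: "M $$ (i, j) = 0" if "i < Suc d" "Suc j < i" for i j
    using eigenbasis_tridiagonal_zero[OF tri, of i j] that by simp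
  have M1: "M $$ (Suc j, j) \<noteq> 0" if "Suc j < Suc d" for j
    using M that by (auto simp: irreducible_tridiagonal_mat_def)
  show ?thesis
  proof (rule first_vector_cyclic[where n = "Suc d" and v = v and N = N
        and X = "\<lambda>x. P x + Q x + R x"])
    show "ordered_basis (Suc d) v"
      using tri by (simp add: eigenbasis_tridiagonal_def)
  next
    fix j assume j: "j < Suc d"
    have "(\<Sum>i<Suc d. scale (N i j) (v i))
        = (\<Sum>i<Suc d. scale (M $$ (i, j) * entry_factor q d a i j) (v i))
          + (\<Sum>i<Suc d. if i = j then scale (?t j + \<alpha>) (v j) else 0)"
      unfolding sum.distrib[symmetric]
      by (rule sum.cong) (auto simp: N_def scale_left_distrib)
    also have "(\<Sum>i<Suc d. if i = j then scale (?t j + \<alpha>) (v j) else 0) = scale (?t j + \<alpha>) (v j)"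
      using j by (subst sum.delta) auto
    also have "(\<Sum>i<Suc d. scale (M $$ (i, j) * entry_factor q d a i j) (v i))
          + scale (?t j + \<alpha>) (v j) = P (v j) + (Q (v j) + R (v j))"
      using third_operator_on_eigenbasis(1)[OF P Q Pv Qv j, of \<alpha>] R
      by (simp add: huang_relation_third_operator Pv[OF j] scale_left_distrib add_ac)
    finally show "P (v j) + Q (v j) + R (v j) = (\<Sum>i<Suc d. scale (N i j) (v i))"
      by (simp add: add.assoc)
  next
    fix i j assume "i < Suc d" "Suc j < i"
    then show "N i j = 0" by (simp add: N_def M0)
  next
    fix j assume "Suc j < Suc d"
    then show "N (Suc j) j \<noteq> 0"
      using M1[of j] entry_factor_subdiagonal_nonzero[OF params, of j] by (simp add: N_def)
  qed (use U in auto)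
qed

end

section \<open>The three products commute\<close>

theorem theorem13p4:
  fixes scale :: "'f::field \<Rightarrow> 'v::ab_group_add \<Rightarrow> 'v"
    and q a b c :: 'f
    and d :: nat
    and A B C W W' W'' :: "'v \<Rightarrow> 'v"
  assumes "vector_space scale"
    and "vector_space.dim scale (UNIV :: 'v set) = d + 1"
    and "huang_parameters q a b c d"
    and "end_algebra.leonard_triple scale d A B C"
    and "end_algebra.q_racah_type scale q A B C a b c d"
    and "W = end_algebra.W_map scale q d a A"
    and "W' = end_algebra.W_map scale q d b B"
    and "W'' = end_algebra.W_map scale q d c C"
  shows "(W' \<circ> W) \<circ> (W'' \<circ> W') = (W'' \<circ> W') \<circ> (W' \<circ> W)
    \<and> (W'' \<circ> W') \<circ> (W \<circ> W'') = (W \<circ> W'') \<circ> (W'' \<circ> W')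
    \<and> (W \<circ> W'') \<circ> (W' \<circ> W) = (W' \<circ> W) \<circ> (W \<circ> W'')"
proof -
  interpret end_algebra scale
    using assms(1) by (simp add: end_algebra_def)
  have q: "q \<noteq> 0" "q ^ 4 \<noteq> 1" and abc: "a \<noteq> 0" "b \<noteq> 0" "c \<noteq> 0"
    using assms(3) by (auto simp: huang_parameters_def)
  have A: "Vector_Spaces.linear scale scale A" and B: "Vector_Spaces.linear scale scale B"
    and C: "Vector_Spaces.linear scale scale C"
    using assms(4) by (auto simp: leonard_triple_def)
  have ord: "standard_ordering d A B C (huang_theta q d a)"
    "standard_ordering d B C A (huang_theta q d b)"
    "standard_ordering d C A B (huang_theta q d c)"
    using assms(5) by (auto simp: q_racah_type_def)
  obtain \<alpha> \<beta> \<gamma> where rel: "huang_relation q A B C \<alpha>" "huang_relation q B C A \<beta>"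
      "huang_relation q C A B \<gamma>"
    using assms(5) by (auto simp: q_racah_type_def)
  obtain vAB MAB where AB: "eigenbasis_tridiagonal q d a A B vAB MAB"
    using standard_ordering_eigenbasis(1)[OF ord(1)] by blast
  obtain vAC MAC where AC: "eigenbasis_tridiagonal q d a A C vAC MAC"
    using standard_ordering_eigenbasis(2)[OF ord(1)] by blast
  obtain vBC MBC where BC: "eigenbasis_tridiagonal q d b B C vBC MBC"
    using standard_ordering_eigenbasis(1)[OF ord(2)] by blast
  obtain vBA MBA where BA: "eigenbasis_tridiagonal q d b B A vBA MBA"
    using standard_ordering_eigenbasis(2)[OF ord(2)] by blast
  obtain vCA MCA where CA: "eigenbasis_tridiagonal q d c C A vCA MCA"
    using standard_ordering_eigenbasis(1)[OF ord(3)] by blast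
  obtain vCB MCB where CB: "eigenbasis_tridiagonal q d c C B vCB MCB"
    using standard_ordering_eigenbasis(2)[OF ord(3)] by blast
  define X where "X x = A x + B x + C x" for x
  have linX: "Vector_Spaces.linear scale scale X"
    using A B C unfolding X_def linear_iff by (simp add: scale_right_distrib add_ac)
  have com1: "(W' \<circ> W) (X x) = X ((W' \<circ> W) x)" for x
    using W_map_product_commutes[OF q abc(1,2) A B AB BA rel(3)] unfolding X_def assms(6,7) .
  have com2: "(W'' \<circ> W') (X x) = X ((W'' \<circ> W') x)" for x
    using W_map_product_commutes[OF q abc(2,3) B C BC CB rel(1), of x]
    unfolding X_def assms(7,8) by (simp add: add_ac)
  have com3: "(W \<circ> W'') (X x) = X ((W \<circ> W'') x)" for x
    using W_map_product_commutes[OF q abc(3,1) C A CA AC rel(2), of x]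
    unfolding X_def assms(6,8) by (simp add: add_ac)
  have "Vector_Spaces.linear scale scale W" "Vector_Spaces.linear scale scale W'"
    "Vector_Spaces.linear scale scale W''"
    unfolding assms(6-8) using linear_W_map AB BC CA A B C by blast+
  then have lin: "Vector_Spaces.linear scale scale (W' \<circ> W)"
    "Vector_Spaces.linear scale scale (W'' \<circ> W')" "Vector_Spaces.linear scale scale (W \<circ> W'')"
    unfolding linear_iff by simp_all
  have cyclic: "x \<in> U" if "subspace U" "vAB 0 \<in> U" "\<And>x. x \<in> U \<Longrightarrow> X x \<in> U" for U x
    using sum_has_cyclic_vector[OF assms(3) A B AB rel(3) that[unfolded X_def]] .
  note centr = centralizer_commutative[OF linX cyclic]
  show ?thesis
    using centr[OF _ _ _ lin(1) com1 lin(2) com2] centr[OF _ _ _ lin(2) com2 lin(3) com3]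
      centr[OF _ _ _ lin(3) com3 lin(1) com1]
    by blast
qed

end
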